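(* Let $\mu\in\{2,i\}$. Then for every $N\in\mathbb{N}$ there exists a neighborhood $U\subseteq\mathbb{C}$ of $2$ such that for every $\lambda\in U$, every relator of $G_{\lambda,\mu}$ has a subword $w$ of the form: (1) if $\mu=2$: $w=(A_\lambda B_2^{-1})^k$ or $w=(A_\lambda^{-1}B_2)^k$, where $k\ge N$; (2) if $\mu=i$: $w=A_\lambda^{n_1}B_i^{n_2}\cdots A_\lambda^{n_{k-1}}B_i^{n_k}$, where $k\ge N$ and $n_j\in\{\pm1\}$ for all $j$. In particular, $\sigma(G_{\lambda,\mu})\to\infty$ as $\lambda\to 2$. Furthermore, a lower bound on the length of $w$ can be computed effectively; more precisely: if $\lambda_n\to 2$ is a sequence in $\mathbb{C}$, then there are effectively computable constants $k_n\in\mathbb{N}$ such that $k_n\to\infty$ and any relator of $G_{\lambda_n,\mu}$ has a subword $w_n$ with $\operatorname{syl}(w_n)\ge k_n$ which, for some $k$, is of the form $(A_{\lambda_n}B_2^{-1})^k$ or $(A_{\lambda_n}^{-1}B_2)^k$ if $\mu=2$, and of the form $A_{\lambda_n}^{m_1}B_i^{m_2}\cdots A_{\lambda_n}^{m_{k-1}}B_i^{m_k}$ with all $m_j\in\{\pm1\}$ if $\mu=i$.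
   Context: For $\lambda,\mu\in\mathbb{C}$ let $A_\lambda=\begin{pmatrix}1&\lambda\\0&1\end{pmatrix}$, $B_\mu=\begin{pmatrix}1&0\\ \mu&1\end{pmatrix}$, and $G_{\lambda,\mu}=\langle A_\lambda,B_\mu\rangle\subseteq\mathrm{SL}_2(\mathbb{C})$, with generating set $S=\{A_\lambda,B_\mu\}$. Words are reduced words in two formal letters corresponding to the generators (elements of the free group on these letters). A relator of $G_{\lambda,\mu}$ always means a nontrivial relator: a nonempty reduced word in the generators that equals $1$ in the group. A subword is a contiguous subword. If $w=s_1^{n_1}\cdots s_k^{n_k}$ is the reduced form of a word ($s_j\in S$, $s_j\neq s_{j+1}^{\pm1}$ as letters, $n_j\in\mathbb{Z}\setminus\{0\}$), its syllables are $s_1^{n_1},\dots,s_k^{n_k}$, and $\operatorname{syl}(w)=k$. For a group $G$ with generating set $S$, $\sigma(G)=\sigma_S(G)$ is the minimum of $\operatorname{syl}(w)$ over all relators $w$, and $\sigma(G)=\infty$ if $S$ freely generates $G$. *)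

theory Defs
  imports
    "HOL-Analysis.Analysis"
    "HOL-Algebra.Generated_Groups"
    "HOL-Library.Sublist"
    "HOL-Library.Nat_Bijection"
    "HOL-Library.Extended_Nat"
begin

section \<open>Words over a set of formal letters\<close>

text \<open>In a letter \<open>(b, s)\<close> the flag \<open>b\<close> is true for the inverse of \<open>s\<close>.\<close>

type_synonym 'a word = "(bool \<times> 'a) list"

definition reduced :: "'a word \<Rightarrow> bool" where
  "reduced w \<longleftrightarrow> successively (\<lambda>x y. \<not> (snd x = snd y \<and> fst x \<noteq> fst y)) w"

definition letter_power :: "'a \<Rightarrow> int \<Rightarrow> 'a word" where
  "letter_power s n = replicate (nat \<bar>n\<bar>) (n < 0, s)"

definition syllable_form :: "('a \<times> int) list \<Rightarrow> 'a word \<Rightarrow> bool" where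
  "syllable_form ys w \<longleftrightarrow>
     w = concat (map (\<lambda>(s, n). letter_power s n) ys) \<and>
     distinct_adj (map fst ys) \<and> (\<forall>(s, n) \<in> set ys. n \<noteq> 0)"

text \<open>Only meaningful for reduced words; these have exactly one syllable form.\<close>

definition syl :: "'a word \<Rightarrow> nat" where
  "syl w = length (THE ys. syllable_form ys w)"



section \<open>Relators\<close>

text \<open>\<open>\<phi>\<close> sends each formal letter to the generator it stands for. Distinct letters
  remain distinct as letters even if the generators happen to coincide in the group.\<close>

definition letter_value :: "('g, 'm) monoid_scheme \<Rightarrow> ('a \<Rightarrow> 'g) \<Rightarrow> bool \<times> 'a \<Rightarrow> 'g" where
  "letter_value G \<phi> x = (if fst x then inv\<^bsub>G\<^esub> \<phi> (snd x) else \<phi> (snd x))"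

definition word_value :: "('g, 'm) monoid_scheme \<Rightarrow> ('a \<Rightarrow> 'g) \<Rightarrow> 'a word \<Rightarrow> 'g" where
  "word_value G \<phi> w = foldr (\<lambda>x g. letter_value G \<phi> x \<otimes>\<^bsub>G\<^esub> g) w \<one>\<^bsub>G\<^esub>"

definition relator :: "('g, 'm) monoid_scheme \<Rightarrow> ('a \<Rightarrow> 'g) \<Rightarrow> 'a word \<Rightarrow> bool" where
  "relator G \<phi> w \<longleftrightarrow> w \<noteq> [] \<and> reduced w \<and> word_value G \<phi> w = \<one>\<^bsub>G\<^esub>"

text \<open>The infimum of the empty set is \<open>\<infinity>\<close>, which is the convention for free generators.\<close>

definition syl_sigma :: "('g, 'm) monoid_scheme \<Rightarrow> ('a \<Rightarrow> 'g) \<Rightarrow> enat" where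
  "syl_sigma G \<phi> = (INF w \<in> {w. relator G \<phi> w}. enat (syl w))"


section \<open>The two-generator matrix groups\<close>

definition SL2C :: "(complex^2^2) monoid" where
  "SL2C = \<lparr>carrier = {M. det M = 1}, mult = (**), one = mat 1\<rparr>"

datatype gen = Gen_A | Gen_B

fun gen_matrix :: "complex \<Rightarrow> complex \<Rightarrow> gen \<Rightarrow> complex^2^2" where
  "gen_matrix l \<mu> Gen_A = vector [vector [1, l], vector [0, 1]]"
| "gen_matrix l \<mu> Gen_B = vector [vector [1, 0], vector [\<mu>, 1]]"

definition G_group :: "complex \<Rightarrow> complex \<Rightarrow> (complex^2^2) monoid" where
  "G_group l \<mu> = SL2C\<lparr>carrier := generate SL2C {gen_matrix l \<mu> Gen_A, gen_matrix l \<mu> Gen_B}\<rparr>"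

abbreviation G_relator :: "complex \<Rightarrow> complex \<Rightarrow> gen word \<Rightarrow> bool" where
  "G_relator l \<mu> \<equiv> relator (G_group l \<mu>) (gen_matrix l \<mu>)"

text \<open>\<open>(A B\<^sup>-\<^sup>1)\<^sup>k\<close> or \<open>(A\<^sup>-\<^sup>1 B)\<^sup>k\<close>: here \<open>k\<close> counts repetitions, so there are \<open>2k\<close> letters.\<close>

definition special_2 :: "nat \<Rightarrow> gen word \<Rightarrow> bool" where
  "special_2 k w \<longleftrightarrow>
     w = concat (replicate k (letter_power Gen_A 1 @ letter_power Gen_B (-1))) \<or>
     w = concat (replicate k (letter_power Gen_A (-1) @ letter_power Gen_B 1))"

text \<open>\<open>A^n(1) B^n(2) \<dots> A^n(k-1) B^n(k)\<close> with all exponents \<open>1\<close> or \<open>-1\<close>: here \<open>k\<close> counts letters, and it is even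
  because the word starts with a power of \<open>A\<close> and ends with a power of \<open>B\<close>.\<close>

definition special_i :: "nat \<Rightarrow> gen word \<Rightarrow> bool" where
  "special_i k w \<longleftrightarrow> even k \<and>
     (\<exists>n :: nat \<Rightarrow> int. (\<forall>j\<in>{1..k}. n j \<in> {1, -1}) \<and>
        w = concat (map (\<lambda>j. letter_power (if odd j then Gen_A else Gen_B) (n j)) [1..<Suc k]))"


section \<open>Effective computability\<close>

text \<open>Programs for the partial recursive functions relative to a function \<open>f\<close> that can be
  queried; \<open>computes f p xs y\<close> says that \<open>p\<close> halts on the arguments \<open>xs\<close> with result \<open>y\<close>.\<close>

datatype prog =
    Zero
  | Succ
  | Proj nat
  | Query
  | Comp prog "prog list"
  | PrimRec prog prog
  | Minimize prog

inductive computes :: "(nat list \<Rightarrow> nat) \<Rightarrow> prog \<Rightarrow> nat list \<Rightarrow> nat \<Rightarrow> bool"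
  for f :: "nat list \<Rightarrow> nat" where
  zero: "computes f Zero xs 0"
| succ: "computes f Succ [x] (Suc x)"
| proj: "i < length xs \<Longrightarrow> computes f (Proj i) xs (xs ! i)"
| query: "computes f Query xs (f xs)"
| comp: "list_all2 (\<lambda>q y. computes f q xs y) qs ys \<Longrightarrow> computes f p ys z
    \<Longrightarrow> computes f (Comp p qs) xs z"
| rec_0: "computes f p xs y \<Longrightarrow> computes f (PrimRec p q) (0 # xs) y"
| rec_Suc: "computes f (PrimRec p q) (n # xs) y \<Longrightarrow> computes f q (n # y # xs) z
    \<Longrightarrow> computes f (PrimRec p q) (Suc n # xs) z"
| minimize: "computes f p (n # xs) 0 \<Longrightarrow> (\<forall>m<n. \<exists>y. computes f p (m # xs) (Suc y))
    \<Longrightarrow> computes f (Minimize p) xs n"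

text \<open>A sequence of complex numbers is presented to a program, as usual in computable
  analysis, by dyadic approximations of the real and imaginary parts of its members to any
  requested precision: on \<open>[0, n, j]\<close> and \<open>[1, n, j]\<close> the function \<open>f\<close> returns codes of integers
  \<open>a\<close> and \<open>b\<close> such that \<open>a / 2\<^sup>j\<close> and \<open>b / 2\<^sup>j\<close> are within \<open>2\<^sup>-\<^sup>j\<close> of \<open>Re (l n)\<close> and \<open>Im (l n)\<close>.\<close>

definition represents :: "(nat list \<Rightarrow> nat) \<Rightarrow> (nat \<Rightarrow> complex) \<Rightarrow> bool" where
  "represents f l \<longleftrightarrow> (\<forall>n j.
     \<bar>Re (l n) - of_int (int_decode (f [0, n, j])) / 2 ^ j\<bar> \<le> 1 / 2 ^ j \<and>
     \<bar>Im (l n) - of_int (int_decode (f [1, n, j])) / 2 ^ j\<bar> \<le> 1 / 2 ^ j)"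

end

theory Submission
  imports Defs
begin

text \<open>
  Let a word act on \<open>\<complex>\<^sup>2\<close>, one syllable at a time from the right. A syllable changes one of
  the two coordinates; record the other coordinate divided by the changed one. In terms of this
  number a syllable with exponent \<open>n\<close> and parameter \<open>c \<in> {\<lambda>, \<mu>}\<close> is the map
  \<open>z \<mapsto> 1 / (n c + z)\<close>, starting at \<open>z = 0\<close>. As long as no denominator vanishes, a suitable
  coordinate vector ends up with both coordinates nonzero, so the word is not a relator
  (\<open>not_relator_spell\<close>).

  Put \<open>d = \<bar>\<lambda> - 2\<bar>\<close> and measure \<open>z\<close> by \<open>\<rho> = \<bar>z\<bar>\<close> if \<open>\<mu> = 2\<close>; if \<open>\<mu> = \<i>\<close>, use \<open>\<rho> = \<bar>Re z\<bar>\<close> before a power of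
  \<open>A\<close> and \<open>\<rho> = 2 \<bar>Im z\<bar>\<close> before a power of \<open>B\<close>. In both cases every syllable satisfies
  \<open>\<rho>' \<le> 1 / (2 - d - \<rho>)\<close>. For \<open>d = 0\<close> this map has a parabolic fixed point at \<open>1\<close>, which is the tangency
  of the ping-pong domains: starting below \<open>1\<close> it creeps up to \<open>1\<close> at the rate \<open>1 - 1 / t\<close>. For small \<open>d\<close> it
  therefore stays below \<open>1\<close> for a number of steps of order \<open>1 / \<surd>d\<close> (\<open>contraction_step\<close>). Moreover any
  syllable that leaves the special pattern resets \<open>\<rho>\<close> to at most \<open>2 / 3\<close>: an exponent of absolute value
  at least \<open>2\<close> makes the denominator large, and for \<open>\<mu> = 2\<close> an exponent of the same sign as its predecessor
  moves \<open>z\<close> away from the tangency. So \<open>\<rho>\<close> can reach \<open>1\<close> only along a special subword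
  of length of order \<open>1 / \<surd>d\<close>, and a relator must contain one. The precise form is
  \<open>relator_contains_special\<close>: \<open>16 d (N + 2)\<^sup>2 \<le> 1\<close> forces a special subword with \<open>2 N\<close> letters.

  The first two claims follow at once. For the third, a program reads off from dyadic approximations
  of \<open>\<lambda>\<^sub>n\<close> with error \<open>2\<^sup>-\<^sup>n\<close> an upper bound for \<open>\<bar>\<lambda>\<^sub>n - 2\<bar>\<close> that tends to \<open>0\<close>, and
  searches for the largest \<open>N\<close> that this bound permits, answering \<open>0\<close> if there is none.
\<close>

section \<open>Syllables of reduced words\<close>

definition syllabic :: "('a \<times> int) list \<Rightarrow> bool" where
  "syllabic ys \<longleftrightarrow> distinct_adj (map fst ys) \<and> (\<forall>y \<in> set ys. snd y \<noteq> 0)"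

definition spell :: "('a \<times> int) list \<Rightarrow> 'a word" where
  "spell ys = concat (map (\<lambda>(s, n). letter_power s n) ys)"

lemma syllable_form_iff: "syllable_form ys w \<longleftrightarrow> w = spell ys \<and> syllabic ys"
  unfolding syllable_form_def spell_def syllabic_def by auto

lemma spell_Nil [simp]: "spell [] = []"
  by (simp add: spell_def)

lemma spell_Cons [simp]: "spell (y # ys) = letter_power (fst y) (snd y) @ spell ys"
  by (simp add: spell_def case_prod_beta)

lemma spell_append: "spell (xs @ ys) = spell xs @ spell ys"
  by (simp add: spell_def)

lemma sublist_spell: "sublist xs ys \<Longrightarrow> sublist (spell xs) (spell ys)"
  unfolding sublist_def by (metis spell_append)

lemma syllabic_Cons:
  "syllabic (y # ys) \<longleftrightarrow> snd y \<noteq> 0 \<and> syllabic ys \<and> (ys \<noteq> [] \<longrightarrow> fst y \<noteq> fst (hd ys))"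
  by (cases ys) (auto simp: syllabic_def)

lemma syllabic_Nil [simp]: "syllabic []"
  by (simp add: syllabic_def)

lemma syllabic_appendD: "syllabic (xs @ ys) \<Longrightarrow> syllabic xs \<and> syllabic ys"
  by (auto simp: syllabic_def distinct_adj_append_iff)

lemma syllabic_sublist: "sublist xs ys \<Longrightarrow> syllabic ys \<Longrightarrow> syllabic xs"
  unfolding sublist_def using syllabic_appendD by blast

lemma letter_power_inject:
  assumes "letter_power s m = letter_power s n" "m \<noteq> 0"
  shows "m = n"
proof -
  have "nat \<bar>m\<bar> = nat \<bar>n\<bar>" "m < 0 \<longleftrightarrow> n < 0"
    using assms by (auto simp: letter_power_def replicate_eq_replicate)
  then show ?thesis by linarith
qed

text \<open>The first syllable can be read off from a word because the next one starts with another
  letter; this is what makes the syllable form unique.\<close>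

lemma first_syllable_spell:
  assumes "syllabic ((s, n) # ys)"
  shows "takeWhile (\<lambda>x. snd x = s) (spell ((s, n) # ys)) = letter_power s n"
    and "dropWhile (\<lambda>x. snd x = s) (spell ((s, n) # ys)) = spell ys"
proof -
  have rest: "spell ys = [] \<or> snd (hd (spell ys)) \<noteq> s"
  proof (cases ys)
    case (Cons y zs)
    then have "snd y \<noteq> 0" "fst y \<noteq> s"
      using assms by (auto simp: syllabic_Cons)
    then obtain j where "nat \<bar>snd y\<bar> = Suc j"
      using not0_implies_Suc by fastforce
    then show ?thesis
      using Cons \<open>fst y \<noteq> s\<close> by (simp add: letter_power_def)
  qed simp
  have all: "\<forall>x\<in>set (letter_power s n). snd x = s"
    by (simp add: letter_power_def)
  have none: "takeWhile (\<lambda>x. snd x = s) (spell ys) = []" "dropWhile (\<lambda>x. snd x = s) (spell ys) = spell ys"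
    using rest by (cases "spell ys"; simp)+
  show "takeWhile (\<lambda>x. snd x = s) (spell ((s, n) # ys)) = letter_power s n"
    using all none by (simp add: takeWhile_append2)
  show "dropWhile (\<lambda>x. snd x = s) (spell ((s, n) # ys)) = spell ys"
    using all none by (simp add: dropWhile_append2)
qed

lemma spell_inject:
  assumes "syllabic xs" "syllabic ys" "spell xs = spell ys"
  shows "xs = ys"
  using assms
proof (induction xs arbitrary: ys)
  case Nil
  then show ?case
    by (cases ys) (auto simp: syllabic_Cons letter_power_def)
next
  case (Cons x xs)
  obtain s n where x: "x = (s, n)" by force
  have n: "n \<noteq> 0" using Cons.prems x by (simp add: syllabic_Cons)
  have ys0: "ys \<noteq> []"
    using Cons.prems(3) n x by (auto simp: letter_power_def)
  then obtain s' n' zs where ys: "ys = (s', n') # zs"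
    by (cases ys) auto
  have n': "n' \<noteq> 0" using Cons.prems ys by (simp add: syllabic_Cons)
  have "snd (hd (spell (x # xs))) = s"
    using n x by (simp add: letter_power_def hd_append)
  moreover have "snd (hd (spell ys)) = s'"
    using n' ys by (simp add: letter_power_def hd_append)
  ultimately have s: "s' = s" using Cons.prems(3) by simp
  have "letter_power s n = letter_power s n'"
    using first_syllable_spell(1)[of s n xs] first_syllable_spell(1)[of s n' zs] Cons.prems x ys s
    by metis
  then have "n = n'" using n letter_power_inject by metis
  moreover have "spell xs = spell zs"
    using first_syllable_spell(2)[of s n xs] first_syllable_spell(2)[of s n' zs] Cons.prems x ys s
    by metis
  then have "xs = zs"
    using Cons.IH Cons.prems(1,2) ys by (simp add: syllabic_Cons)
  ultimately show ?case using x ys s by simp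
qed

lemma syl_spell:
  assumes "syllabic ys"
  shows "syl (spell ys) = length ys"
proof -
  have "(THE xs. syllable_form xs (spell ys)) = ys"
    using assms spell_inject unfolding syllable_form_iff by (intro the_equality) blast+
  then show ?thesis by (simp add: syl_def)
qed

lemma reduced_imp_spell:
  assumes "reduced w"
  shows "\<exists>ys. syllabic ys \<and> w = spell ys"
  using assms
proof (induction w)
  case Nil
  then show ?case by (intro exI[of _ "[]"]) simp
next
  case (Cons x w)
  obtain b s where x: "x = (b, s)" by force
  define e :: int where "e = (if b then -1 else 1)"
  have "reduced w" using Cons.prems by (cases w) (auto simp: reduced_def)
  then obtain ys where ys: "syllabic ys" "w = spell ys" using Cons.IH by blast
  have single: "letter_power s e = [x]"
    by (simp add: e_def x letter_power_def)
  show ?case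
  proof (cases "ys \<noteq> [] \<and> fst (hd ys) = s")
    case True
    then obtain n zs where zs: "ys = (s, n) # zs" by (cases ys) auto
    have n: "n \<noteq> 0" using ys zs by (simp add: syllabic_Cons)
    then have "hd w = (n < 0, s)" "w \<noteq> []"
      using ys zs by (auto simp: letter_power_def hd_append)
    then have sign: "b \<longleftrightarrow> n < 0"
      using Cons.prems x by (cases w) (auto simp: reduced_def)
    have "nat \<bar>n + e\<bar> = Suc (nat \<bar>n\<bar>)" "n + e < 0 \<longleftrightarrow> b"
      using sign n by (auto simp: e_def)
    then have "letter_power s (n + e) = x # letter_power s n" "n + e \<noteq> 0"
      using sign x by (auto simp: letter_power_def)
    then have "syllabic ((s, n + e) # zs)" "x # w = spell ((s, n + e) # zs)"
      using ys zs by (auto simp: syllabic_Cons)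
    then show ?thesis by blast
  next
    case False
    then have "syllabic ((s, e) # ys)" "x # w = spell ((s, e) # ys)"
      using ys single by (auto simp: syllabic_Cons e_def)
    then show ?thesis by blast
  qed
qed

section \<open>The action of a word on a vector\<close>

fun other :: "gen \<Rightarrow> gen" where
  "other Gen_A = Gen_B"
| "other Gen_B = Gen_A"

lemma other_iff: "s \<noteq> t \<longleftrightarrow> t = other s"
  by (cases s; cases t) auto

fun coord :: "gen \<Rightarrow> complex^2 \<Rightarrow> complex" where
  "coord Gen_A v = v $ 1"
| "coord Gen_B v = v $ 2"

fun shift :: "complex \<Rightarrow> complex \<Rightarrow> gen \<Rightarrow> complex" where
  "shift l \<mu> Gen_A = l"
| "shift l \<mu> Gen_B = \<mu>"

lemma group_SL2C: "group SL2C"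
proof (rule groupI)
  fix x assume "x \<in> carrier SL2C"
  then have x: "det x = 1" by (simp add: SL2C_def)
  then have "invertible x" by (simp add: invertible_det_nz)
  then obtain y where y: "y ** x = mat 1" by (auto simp: invertible_def)
  then have "det y * det x = 1" by (metis det_mul det_I)
  then have "y \<in> carrier SL2C" using x by (simp add: SL2C_def)
  then show "\<exists>y\<in>carrier SL2C. y \<otimes>\<^bsub>SL2C\<^esub> x = \<one>\<^bsub>SL2C\<^esub>"
    using y by (auto simp: SL2C_def)
qed (auto simp: SL2C_def det_mul matrix_mul_assoc)

lemma gen_matrix_carrier: "gen_matrix l \<mu> s \<in> carrier SL2C"
  by (cases s) (auto simp: SL2C_def det_2)

lemma gen_matrix_inverse: "gen_matrix (- l) (- \<mu>) s ** gen_matrix l \<mu> s = mat 1"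
  by (cases s) (auto simp: vec_eq_iff matrix_matrix_mult_def sum_2 forall_2 mat_def)

lemma letter_value_G:
  "letter_value (G_group l \<mu>) (gen_matrix l \<mu>) (b, s) =
     (if b then gen_matrix (- l) (- \<mu>) s else gen_matrix l \<mu> s)"
proof -
  let ?S = "{gen_matrix l \<mu> Gen_A, gen_matrix l \<mu> Gen_B}"
  interpret SL: group SL2C by (rule group_SL2C)
  have sub: "?S \<subseteq> carrier SL2C" using gen_matrix_carrier by blast
  have mem: "gen_matrix l \<mu> s \<in> generate SL2C ?S"
    by (cases s) (auto intro: generate.incl)
  have "inv\<^bsub>SL2C\<^esub> gen_matrix l \<mu> s = gen_matrix (- l) (- \<mu>) s"
    using gen_matrix_inverse gen_matrix_carrier
    by (intro SL.inv_equality) (auto simp: SL2C_def)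
  moreover have "inv\<^bsub>G_group l \<mu>\<^esub> gen_matrix l \<mu> s = inv\<^bsub>SL2C\<^esub> gen_matrix l \<mu> s"
    unfolding G_group_def
    using SL.m_inv_consistent[OF SL.generate_is_subgroup[OF sub] mem] .
  ultimately show ?thesis by (simp add: letter_value_def)
qed

abbreviation act :: "complex \<Rightarrow> complex \<Rightarrow> gen word \<Rightarrow> complex^2 \<Rightarrow> complex^2" where
  "act l \<mu> w v \<equiv> word_value (G_group l \<mu>) (gen_matrix l \<mu>) w *v v"

lemma act_Cons:
  "coord s (act l \<mu> ((b, s) # w) v) =
     coord s (act l \<mu> w v) + (if b then - 1 else 1) * shift l \<mu> s * coord (other s) (act l \<mu> w v)"
  "coord (other s) (act l \<mu> ((b, s) # w) v) = coord (other s) (act l \<mu> w v)"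
proof -
  have "act l \<mu> ((b, s) # w) v =
      (if b then gen_matrix (- l) (- \<mu>) s else gen_matrix l \<mu> s) *v act l \<mu> w v"
    unfolding word_value_def
    by (simp add: letter_value_G matrix_vector_mul_assoc) (simp add: G_group_def SL2C_def)
  then show "coord s (act l \<mu> ((b, s) # w) v) =
     coord s (act l \<mu> w v) + (if b then - 1 else 1) * shift l \<mu> s * coord (other s) (act l \<mu> w v)"
    "coord (other s) (act l \<mu> ((b, s) # w) v) = coord (other s) (act l \<mu> w v)"
    by (cases s; auto simp: matrix_vector_mult_def sum_2)+
qed

lemma act_letter_power:
  "coord s (act l \<mu> (letter_power s n @ w) v) =
     coord s (act l \<mu> w v) + of_int n * shift l \<mu> s * coord (other s) (act l \<mu> w v)"
  "coord (other s) (act l \<mu> (letter_power s n @ w) v) = coord (other s) (act l \<mu> w v)"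
proof -
  have rep: "coord s (act l \<mu> (replicate k (b, s) @ w) v) = coord s (act l \<mu> w v)
       + of_nat k * ((if b then - 1 else 1) * shift l \<mu> s * coord (other s) (act l \<mu> w v))
     \<and> coord (other s) (act l \<mu> (replicate k (b, s) @ w) v) = coord (other s) (act l \<mu> w v)"
    for k b
    by (induction k) (auto simp: act_Cons algebra_simps simp del: coord.simps)
  have "(of_int n :: complex) = of_nat (nat \<bar>n\<bar>) * (if n < 0 then - 1 else 1)"
    by (simp add: of_nat_nat)
  then show "coord s (act l \<mu> (letter_power s n @ w) v) =
     coord s (act l \<mu> w v) + of_int n * shift l \<mu> s * coord (other s) (act l \<mu> w v)"
    "coord (other s) (act l \<mu> (letter_power s n @ w) v) = coord (other s) (act l \<mu> w v)"
    using rep[of "nat \<bar>n\<bar>" "n < 0"] by (auto simp: letter_power_def mult.assoc)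
qed

text \<open>The coordinate not touched by the first syllable divided by the one that it changes, when the word
  acts on the vector whose only nonzero coordinate is the one not changed by the last syllable. On
  reaching a zero denominator the value is \<open>0\<close> because \<open>inverse 0 = 0\<close>, so a nonzero value certifies a nonzero
  denominator.\<close>

fun ratio :: "complex \<Rightarrow> complex \<Rightarrow> (gen \<times> int) list \<Rightarrow> complex" where
  "ratio l \<mu> [] = 0"
| "ratio l \<mu> ((s, n) # ys) = inverse (of_int n * shift l \<mu> s + ratio l \<mu> ys)"

text \<open>The relation between the two coordinates propagates because consecutive syllables change different
  coordinates: the denominator of the next ratio is the quotient of the changed coordinate by
  the other one.\<close>

lemma act_ratio:
  assumes "ys \<noteq> []" "syllabic ys"
    and "\<And>zs. suffix zs ys \<Longrightarrow> zs \<noteq> [] \<Longrightarrow> ratio l \<mu> zs \<noteq> 0"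
    and "coord (fst (last ys)) v = 0" "coord (other (fst (last ys))) v = 1"
  shows "coord (fst (hd ys)) (act l \<mu> (spell ys) v) \<noteq> 0 \<and>
    coord (other (fst (hd ys))) (act l \<mu> (spell ys) v) =
      ratio l \<mu> ys * coord (fst (hd ys)) (act l \<mu> (spell ys) v)"
  using assms
proof (induction ys rule: list_nonempty_induct)
  case (single x)
  obtain s n where x: "x = (s, n)" by force
  have "ratio l \<mu> [(s, n)] \<noteq> 0" using single.prems(2)[of "[x]"] x by simp
  moreover have "act l \<mu> [] v = v" by (simp add: word_value_def G_group_def SL2C_def)
  ultimately show ?case
    using single.prems(3,4) act_letter_power[of s l \<mu> n "[]" v] x
    by (auto simp: field_simps simp del: coord.simps)
next
  case (cons x ys)
  obtain s n where x: "x = (s, n)" by force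
  have hd: "fst (hd ys) = other s"
    using cons.prems(1) cons.hyps x other_iff by (auto simp: syllabic_Cons)
  have oo: "other (other s) = s" by (cases s) auto
  have IH: "coord (other s) (act l \<mu> (spell ys) v) \<noteq> 0"
    "coord s (act l \<mu> (spell ys) v) = ratio l \<mu> ys * coord (other s) (act l \<mu> (spell ys) v)"
    using cons.IH cons.prems cons.hyps hd oo
    by (auto simp: syllabic_Cons suffix_ConsI simp del: coord.simps)
  have "ratio l \<mu> (x # ys) \<noteq> 0" using cons.prems(2)[of "x # ys"] by simp
  then have "of_int n * shift l \<mu> s + ratio l \<mu> ys \<noteq> 0" using x by auto
  moreover have "coord s (act l \<mu> (spell (x # ys)) v) =
      (of_int n * shift l \<mu> s + ratio l \<mu> ys) * coord (other s) (act l \<mu> (spell ys) v)"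
    using IH(2) x by (simp add: act_letter_power algebra_simps del: coord.simps)
  moreover have "coord (other s) (act l \<mu> (spell (x # ys)) v) = coord (other s) (act l \<mu> (spell ys) v)"
    using x by (simp add: act_letter_power del: coord.simps)
  ultimately show ?case
    using IH(1) x by (simp del: coord.simps spell_Cons)
qed

text \<open>By \<open>act_ratio\<close> both coordinates of the image of the chosen vector are nonzero, while one coordinate of
  the vector itself is zero. So the word does not act as the identity.\<close>

lemma not_relator_spell:
  assumes "syllabic ys"
    and "\<And>zs. suffix zs ys \<Longrightarrow> zs \<noteq> [] \<Longrightarrow> ratio l \<mu> zs \<noteq> 0"
  shows "\<not> G_relator l \<mu> (spell ys)"
proof
  assume r: "G_relator l \<mu> (spell ys)"
  then have "ys \<noteq> []" by (auto simp: relator_def)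
  obtain v where v: "coord (fst (last ys)) v = 0" "coord (other (fst (last ys))) v = 1"
  proof (cases "fst (last ys)")
    case Gen_A
    then show ?thesis using that[of "vector [0, 1]"] by simp
  next
    case Gen_B
    then show ?thesis using that[of "vector [1, 0]"] by simp
  qed
  let ?u = "act l \<mu> (spell ys) v"
  have "word_value (G_group l \<mu>) (gen_matrix l \<mu>) (spell ys) = mat 1"
    using r by (simp add: relator_def G_group_def SL2C_def)
  then have fixed: "?u = v" by simp
  have nz: "ratio l \<mu> ys \<noteq> 0"
    using assms(2)[of ys] \<open>ys \<noteq> []\<close> by simp
  have "coord (fst (hd ys)) ?u \<noteq> 0" "coord (other (fst (hd ys))) ?u \<noteq> 0"
    using act_ratio[OF \<open>ys \<noteq> []\<close> assms v] nz by (auto simp del: coord.simps)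
  then have "coord (fst (last ys)) ?u \<noteq> 0"
    using other_iff[of "fst (hd ys)" "fst (last ys)"] by (cases "fst (hd ys) = fst (last ys)") simp_all
  then show False using v(1) fixed by simp
qed

section \<open>Quantitative ping-pong\<close>

text \<open>In the coordinate \<open>u = 1 / (1 - \<rho>)\<close> the map \<open>\<rho> \<mapsto> 1 / (2 - \<rho>)\<close> is the translation \<open>u \<mapsto> u + 1\<close>.
  Its perturbation by \<open>d\<close> is bounded by the translation by \<open>2\<close> as long as \<open>d u (u + 1) \<le> 1\<close>; here \<open>u = 2 t + 3\<close>
  after \<open>t\<close> steps from \<open>\<rho> = 2 / 3\<close>.\<close>

lemma contraction_step:
  fixes d \<rho> t :: real
  assumes "0 \<le> t" "d * (2 * t + 3) * (2 * t + 4) \<le> 1" "\<rho> \<le> 1 - 1 / (2 * t + 3)"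
  shows "1 / (2 - d - \<rho>) \<le> 1 - 1 / (2 * t + 5)"
proof -
  define u where "u = 2 * t + 3"
  have u: "u \<ge> 3" using assms(1) by (simp add: u_def)
  have "d * u * (u + 1) \<le> 1" using assms(2) by (simp add: u_def algebra_simps)
  then have d: "d * (u + 1) \<le> 1 / u"
    using u by (simp add: field_simps)
  have "(1 + 1 / u - d) * (u + 1) = u + 2 + (1 / u - d * (u + 1))"
    using u by (simp add: field_simps)
  then have main: "u + 2 \<le> (1 + 1 / u - d) * (u + 1)" using d by simp
  have "u + 2 \<le> (2 - d - \<rho>) * (u + 1)"
    using assms(3) u by (intro order_trans[OF main] mult_right_mono) (simp_all add: u_def)
  moreover from this have pos: "0 < 2 - d - \<rho>"
    using u by (smt (verit) mult_nonpos_nonneg)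
  ultimately have "1 / (2 - d - \<rho>) \<le> (u + 1) / (u + 2)"
    using u by (simp add: field_simps)
  also have "\<dots> = 1 - 1 / (2 * t + 5)" using assms(1) by (simp add: u_def field_simps)
  finally show "1 / (2 - d - \<rho>) \<le> 1 - 1 / (2 * t + 5)" .
qed

text \<open>The size is bounded in terms of the length of a chain at the front of the list. A step outside
  the pattern makes the size at most \<open>2 / 3\<close>, which is the bound for the empty chain. A step that prolongs the chain
  is an instance of \<open>contraction_step\<close>, available because chains in \<open>ys\<close> are too short for the
  perturbation to accumulate. The predicate \<open>J\<close> carries whatever else the induction
  needs.\<close>

lemma chain_bound:
  fixes d :: real and size :: "'a list \<Rightarrow> real" and J :: "'a list \<Rightarrow> bool"
  assumes short: "\<And>zs. sublist zs ys \<Longrightarrow> C zs \<Longrightarrow> d * (2 * length zs + 3) * (2 * length zs + 4) \<le> 1"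
    and start: "C []" "J []" "size [] \<le> 2 / 3"
    and step: "\<And>x xs zs. suffix (x # xs) ys \<Longrightarrow> J xs \<Longrightarrow> size xs < 1 \<Longrightarrow> prefix zs xs \<Longrightarrow> C zs \<Longrightarrow>
        J (x # xs) \<and>
        (size (x # xs) \<le> 2 / 3 \<or> C (x # zs) \<and> size (x # xs) \<le> 1 / (2 - d - size xs))"
    and "suffix xs ys"
  shows "J xs \<and> (\<exists>zs. prefix zs xs \<and> C zs \<and> size xs \<le> 1 - 1 / (2 * length zs + 3))"
  using \<open>suffix xs ys\<close>
proof (induction xs)
  case Nil
  show ?case using start by (intro conjI exI[of _ "[]"]) simp_all
next
  case (Cons x xs)
  have "suffix xs ys" using suffix_ConsD[OF Cons.prems] .
  from Cons.IH[OF this] obtain zs where J: "J xs"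
    and zs: "prefix zs xs" "C zs" "size xs \<le> 1 - 1 / (2 * length zs + 3)"
    by (elim conjE exE)
  have "0 < 1 / real (2 * length zs + 3)" by simp
  then have "size xs < 1" using zs(3) by linarith
  have "sublist zs ys"
    using sublist_order.order.trans[OF prefix_imp_sublist[OF zs(1)] suffix_imp_sublist[OF \<open>suffix xs ys\<close>]] .
  note d = short[OF this zs(2)]
  note next_step = step[OF Cons.prems J \<open>size xs < 1\<close> zs(1,2)]
  then have J': "J (x # xs)" ..
  from next_step consider "size (x # xs) \<le> 2 / 3"
    | "C (x # zs)" "size (x # xs) \<le> 1 / (2 - d - size xs)" by (elim conjE disjE)
  then show ?case
  proof cases
    case 1
    then show ?thesis using J' start by (intro conjI exI[of _ "[]"]) simp_all
  next
    case 2
    have "size (x # xs) \<le> 1 - 1 / (2 * length zs + 5)"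
      using contraction_step[of "length zs" d "size xs"] d zs(3) 2 by simp
    then show ?thesis
      using 2 J' zs by (intro conjI exI[of _ "x # zs"]) (simp_all add: add_ac)
  qed
qed

text \<open>The two kinds of chains consist of the syllables that keep the ping-pong near its tangency, for
  \<open>\<mu> = \<i>\<close> and \<open>\<mu> = 2\<close> respectively.\<close>

definition unit_chain :: "('a \<times> int) list \<Rightarrow> bool" where
  "unit_chain zs \<longleftrightarrow> (\<forall>z\<in>set zs. \<bar>snd z\<bar> = 1)"

definition alternating_chain :: "('a \<times> int) list \<Rightarrow> bool" where
  "alternating_chain zs \<longleftrightarrow> unit_chain zs \<and> successively (\<lambda>x y. snd y = - snd x) zs"

lemma norm_inverse_le_Re:
  assumes "0 < a" "a \<le> Re (of_int e * z)" "\<bar>e\<bar> = 1"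
  shows "norm (inverse z) \<le> 1 / a" "0 \<le> Re (of_int e * inverse z)" "z \<noteq> 0"
proof -
  have e: "e = 1 \<or> e = -1" using assms(3) by linarith
  have "Re (of_int e * z) \<le> norm z"
    using complex_Re_le_cmod[of "of_int e * z"] e by (auto simp: norm_mult)
  then have "a \<le> norm z" using assms by linarith
  then show "norm (inverse z) \<le> 1 / a"
    using assms(1) le_imp_inverse_le[of a "norm z"] by (simp add: norm_inverse inverse_eq_divide[of a])
  show "0 \<le> Re (of_int e * inverse z)"
    using e assms by (auto simp: divide_nonneg_nonneg divide_nonpos_nonneg)
  show "z \<noteq> 0" using assms by auto
qed

text \<open>Everything is read off from the real part of the denominator in the direction \<open>e\<close> of the exponent \<open>n\<close>:
  it is at least \<open>\<bar>n\<bar> (2 - d)\<close> plus \<open>e\<close> times the real part of the previous ratio. After a syllable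
  the ratio points in the direction of its exponent, so the last term can be negative only if the
  sign of the exponent changes.\<close>

lemma ratio_nonzero_2:
  assumes d: "norm (l - 2) = d"
    and short: "\<And>zs. sublist zs ys \<Longrightarrow> alternating_chain zs \<Longrightarrow> d * (2 * length zs + 3) * (2 * length zs + 4) \<le> 1"
    and "syllabic ys" "suffix xs ys" "xs \<noteq> []"
  shows "ratio l 2 xs \<noteq> 0"
proof -
  have d0: "0 \<le> d" using d by auto
  have d1: "d \<le> 1 / 12"
    using short[of "[]"] by (simp add: alternating_chain_def unit_chain_def)
  have "\<bar>Re (l - 2)\<bar> \<le> d" using abs_Re_le_cmod d by metis
  then have Re_shift: "Re (shift l 2 s) \<ge> 2 - d" for s
    using d0 by (cases s) auto
  \<comment> \<open>The second part says that the ratio points in the direction of the exponent just used.\<close>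
  define J where "J = (\<lambda>xs. (xs \<noteq> [] \<longrightarrow> ratio l 2 xs \<noteq> 0) \<and>
      (xs \<noteq> [] \<longrightarrow> 0 \<le> Re (of_int (sgn (snd (hd xs))) * ratio l 2 xs)))"
  have step: "J (x # zs) \<and> (norm (ratio l 2 (x # zs)) \<le> 2 / 3 \<or>
      alternating_chain (x # cs) \<and> norm (ratio l 2 (x # zs)) \<le> 1 / (2 - d - norm (ratio l 2 zs)))"
    if suf: "suffix (x # zs) ys" and J: "J zs" and lt: "norm (ratio l 2 zs) < 1"
      and cs: "prefix cs zs" "alternating_chain cs" for x zs cs
  proof -
    obtain s n where x: "x = (s, n)" by force
    have syl: "syllabic (x # zs)"
      using suf \<open>syllabic ys\<close> syllabic_sublist suffix_imp_sublist by blast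
    then have n: "n \<noteq> 0" using x by (simp add: syllabic_Cons)
    define e where "e = sgn n"
    have e: "\<bar>e\<bar> = 1" "e * n = \<bar>n\<bar>" using n by (auto simp: e_def sgn_if)
    define z where "z = of_int n * shift l 2 s + ratio l 2 zs"
    have r: "ratio l 2 (x # zs) = inverse z" by (simp add: x z_def)
    have Re_e_z: "Re (of_int e * z) = of_int (e * n) * Re (shift l 2 s) + Re (of_int e * ratio l 2 zs)"
      by (simp add: z_def algebra_simps)
    define b where "b = of_int \<bar>n\<bar> * (2 - d)"
    have "b \<le> of_int (e * n) * Re (shift l 2 s)"
      unfolding b_def e(2) using Re_shift[of s] by (intro mult_left_mono) auto
    define p where "p = Re (of_int e * ratio l 2 zs)"
    define q where "q = Re (of_int e * z)"
    have Re_z: "q \<ge> b + p"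
      using Re_e_z \<open>b \<le> _\<close> unfolding p_def q_def by simp
    have e_ratio: "p \<ge> - norm (ratio l 2 zs)"
    proof -
      have "\<bar>Re (of_int e * ratio l 2 zs)\<bar> \<le> norm (of_int e * ratio l 2 zs)"
        by (rule abs_Re_le_cmod)
      also have "\<dots> = norm (ratio l 2 zs)"
        using e(1) by (simp add: norm_mult flip: of_int_abs)
      finally show ?thesis unfolding p_def by linarith
    qed
    have "2 - d \<le> b"
      unfolding b_def using n d1 mult_right_mono[of 1 "of_int \<bar>n\<bar>" "2 - d"] by simp
    then have basic: "2 - d - norm (ratio l 2 zs) \<le> q"
      using Re_z e_ratio by linarith
    have pos: "0 < 2 - d - norm (ratio l 2 zs)" using lt d1 by linarith
    note inv = norm_inverse_le_Re[OF pos basic[unfolded q_def] e(1)]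
    have "J (x # zs)"
      using inv(2,3) r by (simp add: J_def x e_def)
    moreover have "norm (inverse z) \<le> 2 / 3" if "\<not> alternating_chain (x # cs)"
    proof -
      have "3 / 2 \<le> q"
      proof (cases "\<bar>n\<bar> = 1")
        case True
        have "alternating_chain [x]"
          using True by (simp add: alternating_chain_def unit_chain_def x)
        then have "cs \<noteq> []" using that by auto
        then have hd: "zs \<noteq> []" "hd zs = hd cs" using cs(1) by (auto simp: prefix_def)
        obtain y cs' where y: "cs = y # cs'" using \<open>cs \<noteq> []\<close> by (cases cs) auto
        have "\<bar>snd y\<bar> = 1" "snd y \<noteq> - n"
          using that cs(2) True y x by (auto simp: alternating_chain_def unit_chain_def)
        then have "snd y = n" using True by linarith
        then have "0 \<le> p"
          using J hd y by (simp add: J_def e_def p_def)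
        moreover have "b = 2 - d" using True by (simp add: b_def flip: of_int_abs)
        ultimately show ?thesis using Re_z d1 by linarith
      next
        case False
        then have "\<bar>n\<bar> \<ge> 2" using n by linarith
        then have "4 - 2 * d \<le> b"
          unfolding b_def using d1 mult_right_mono[of 2 "of_int \<bar>n\<bar>" "2 - d"] by simp
        then show ?thesis using Re_z e_ratio lt d1 by linarith
      qed
      then show ?thesis using norm_inverse_le_Re(1)[of "3/2" e z] e(1) by (simp add: q_def)
    qed
    ultimately show ?thesis using inv(1) r by metis
  qed
  have start: "alternating_chain []" "J []"
    by (simp_all add: J_def alternating_chain_def unit_chain_def)
  have "J xs"
    using chain_bound[of ys alternating_chain d J "\<lambda>xs. norm (ratio l 2 xs)" xs,
        OF short start _ step \<open>suffix xs ys\<close>] by simp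
  then show ?thesis using \<open>xs \<noteq> []\<close> by (simp add: J_def)
qed

text \<open>Inversion maps the outside of a strip about an axis through \<open>0\<close> into two discs tangent to this axis
  at \<open>0\<close>. These lie in a strip in the perpendicular direction.\<close>

lemma inverse_strip:
  fixes z :: complex
  assumes "0 < a"
  shows "a \<le> \<bar>Re z\<bar> \<Longrightarrow> 2 * \<bar>Im (inverse z)\<bar> \<le> 1 / a"
    and "a \<le> 2 * \<bar>Im z\<bar> \<Longrightarrow> \<bar>Re (inverse z)\<bar> \<le> 1 / a"
proof -
  define D where "D = (Re z)\<^sup>2 + (Im z)\<^sup>2"
  have inv: "\<bar>Re (inverse z)\<bar> = \<bar>Re z\<bar> / D" "\<bar>Im (inverse z)\<bar> = \<bar>Im z\<bar> / D"
    by (simp_all add: D_def)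
  have key: "2 * (\<bar>u\<bar> * \<bar>v\<bar>) \<le> u\<^sup>2 + v\<^sup>2" for u v :: real
    using sum_squares_bound[of "\<bar>u\<bar>" "\<bar>v\<bar>"] by simp
  show "2 * \<bar>Im (inverse z)\<bar> \<le> 1 / a" if "a \<le> \<bar>Re z\<bar>"
  proof -
    have "0 < D"
      unfolding D_def using that assms by (intro add_pos_nonneg) auto
    moreover have "a * (2 * \<bar>Im z\<bar>) \<le> D"
      unfolding D_def using key[of "Re z" "Im z"] mult_right_mono[OF that, of "2 * \<bar>Im z\<bar>"] by simp
    ultimately show ?thesis
      using assms unfolding inv by (simp add: field_simps)
  qed
  show "\<bar>Re (inverse z)\<bar> \<le> 1 / a" if "a \<le> 2 * \<bar>Im z\<bar>"
  proof -
    have "0 < D"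
      unfolding D_def using that assms by (intro add_nonneg_pos) auto
    moreover have "a * \<bar>Re z\<bar> \<le> D"
      unfolding D_def using key[of "Re z" "Im z"] mult_right_mono[OF that, of "\<bar>Re z\<bar>"] by (simp add: mult_ac)
    ultimately show ?thesis
      using assms unfolding inv by (simp add: field_simps)
  qed
qed

text \<open>The factor \<open>2\<close> balances the step widths \<open>2\<close> (of \<open>A\<close>) and \<open>1\<close> (of \<open>B\<close>): both
  then change the width by at most about \<open>2\<close>, and both inversions obey the same bound.\<close>

fun strip_width :: "gen \<Rightarrow> complex \<Rightarrow> real" where
  "strip_width Gen_A z = \<bar>Re z\<bar>"
| "strip_width Gen_B z = 2 * \<bar>Im z\<bar>"

text \<open>Powers of \<open>A\<close> translate horizontally and powers of \<open>B\<close> vertically, so only the width of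
  the strip in the relevant direction matters. The width is even in each direction, which is why this case
  leads to chains of exponents \<open>\<plusminus>1\<close> with arbitrary signs.\<close>

lemma ratio_nonzero_i:
  assumes d: "norm (l - 2) = d"
    and short: "\<And>zs. sublist zs ys \<Longrightarrow> unit_chain zs \<Longrightarrow> d * (2 * length zs + 3) * (2 * length zs + 4) \<le> 1"
    and "syllabic ys" "suffix xs ys" "xs \<noteq> []"
  shows "ratio l \<i> xs \<noteq> 0"
proof -
  have d0: "0 \<le> d" using d by auto
  have d1: "d \<le> 1 / 12"
    using short[of "[]"] by (simp add: unit_chain_def)
  have "\<bar>Re (l - 2)\<bar> \<le> d" using abs_Re_le_cmod d by metis
  then have width_shift: "strip_width s (of_int n * shift l \<i> s) \<ge> of_int \<bar>n\<bar> * (2 - d)" for s n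
  proof (cases s)
    case Gen_A
    have "\<bar>Re l\<bar> \<ge> 2 - d" using \<open>\<bar>Re (l - 2)\<bar> \<le> d\<close> by simp
    then have "of_int \<bar>n\<bar> * (2 - d) \<le> of_int \<bar>n\<bar> * \<bar>Re l\<bar>" by (intro mult_left_mono) auto
    then show ?thesis by (simp add: Gen_A abs_mult)
  next
    case Gen_B
    have "of_int \<bar>n\<bar> * (2 - d) \<le> of_int \<bar>n\<bar> * 2" using d0 by (intro mult_left_mono) auto
    then show ?thesis by (simp add: Gen_B)
  qed
  have triangle: "strip_width s (z + z') \<ge> strip_width s z - strip_width s z'" for s z z'
    by (cases s; simp) (smt (verit))+
  have invert: "strip_width (other s) (inverse z) \<le> 1 / a \<and> z \<noteq> 0" if "0 < a" "a \<le> strip_width s z" for a s z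
    using inverse_strip[OF \<open>0 < a\<close>, of z] that by (cases s) auto
  define size where "size = (\<lambda>xs. if xs = [] then 0 else strip_width (other (fst (hd xs))) (ratio l \<i> xs))"
  define J where "J = (\<lambda>xs. xs \<noteq> [] \<longrightarrow> ratio l \<i> xs \<noteq> 0)"
  have step: "J (x # zs) \<and> (size (x # zs) \<le> 2 / 3 \<or>
      unit_chain (x # cs) \<and> size (x # zs) \<le> 1 / (2 - d - size zs))"
    if suf: "suffix (x # zs) ys" and lt: "size zs < 1" and cs: "unit_chain cs" for x zs cs
  proof -
    obtain s n where x: "x = (s, n)" by force
    have syl: "syllabic (x # zs)"
      using suf \<open>syllabic ys\<close> syllabic_sublist suffix_imp_sublist by blast
    then have n: "n \<noteq> 0" using x by (simp add: syllabic_Cons)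
    define z where "z = of_int n * shift l \<i> s + ratio l \<i> zs"
    have r: "ratio l \<i> (x # zs) = inverse z" by (simp add: x z_def)
    have "strip_width s (ratio l \<i> zs) = size zs"
    proof (cases "zs = []")
      case True
      then show ?thesis by (cases s) (auto simp: size_def)
    next
      case False
      then have "s \<noteq> fst (hd zs)" using syl x by (simp add: syllabic_Cons)
      then have "other (fst (hd zs)) = s" using other_iff by metis
      then show ?thesis using False by (simp add: size_def)
    qed
    moreover define b where "b = of_int \<bar>n\<bar> * (2 - d)"
    ultimately have wide: "b - size zs \<le> strip_width s z"
      using triangle[of s "of_int n * shift l \<i> s" "ratio l \<i> zs"] width_shift[of n s]
      unfolding z_def by linarith
    have size': "size (x # zs) = strip_width (other s) (inverse z)"
      using r by (simp add: size_def x)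
    have "2 - d \<le> b"
      unfolding b_def using n d1 mult_right_mono[of 1 "of_int \<bar>n\<bar>" "2 - d"] by simp
    then have basic: "2 - d - size zs \<le> strip_width s z" using wide by linarith
    have pos: "0 < 2 - d - size zs" using lt d1 by linarith
    have "size (x # zs) \<le> 2 / 3" if "\<not> unit_chain (x # cs)"
    proof -
      have "\<bar>n\<bar> \<ge> 2" using that cs n x by (auto simp: unit_chain_def)
      then have "4 - 2 * d \<le> b"
          unfolding b_def using d1 mult_right_mono[of 2 "of_int \<bar>n\<bar>" "2 - d"] by simp
      then have "3 / 2 \<le> strip_width s z" using wide lt d1 by linarith
      then show ?thesis using invert[of "3/2" s z] size' by simp
    qed
    moreover have "inverse z \<noteq> 0" "size (x # zs) \<le> 1 / (2 - d - size zs)"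
      using invert[OF pos basic] size' by simp_all
    ultimately show ?thesis using r by (metis J_def list.discI)
  qed
  have start: "unit_chain []" "J []" "size [] \<le> 2 / 3"
    by (simp_all add: J_def size_def unit_chain_def)
  have "J xs"
    using chain_bound[of ys unit_chain d J size xs, OF short start step \<open>suffix xs ys\<close>] by simp
  then show ?thesis using \<open>xs \<noteq> []\<close> by (simp add: J_def)
qed

section \<open>Relators contain long special words\<close>

lemma unit_chain_sublist: "sublist xs ys \<Longrightarrow> unit_chain ys \<Longrightarrow> unit_chain xs"
  unfolding unit_chain_def using set_mono_sublist by blast

lemma alternating_chain_sublist: "sublist xs ys \<Longrightarrow> alternating_chain ys \<Longrightarrow> alternating_chain xs"
  unfolding alternating_chain_def
  by (auto simp: unit_chain_sublist sublist_def successively_append_iff)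

lemma special_2_spell:
  assumes "syllabic ws" "alternating_chain ws" "length ws = 2 * k" "ws \<noteq> [] \<Longrightarrow> hd ws = (Gen_A, e)"
  shows "spell ws = concat (replicate k (letter_power Gen_A e @ letter_power Gen_B (- e)))"
  using assms
proof (induction k arbitrary: ws)
  case (Suc k)
  then obtain x y vs where ws: "ws = x # y # vs"
    by (cases ws; cases "tl ws") auto
  have x: "x = (Gen_A, e)" using Suc.prems(4) ws by simp
  have "fst y = Gen_B" "snd y = - e"
    using Suc.prems(1,2) ws x other_iff[of Gen_A "fst y"]
    by (auto simp: syllabic_Cons alternating_chain_def)
  then have y: "y = (Gen_B, - e)" by (simp add: prod_eq_iff)
  have hd: "hd vs = (Gen_A, e)" if "vs \<noteq> []"
  proof -
    have "fst (hd vs) \<noteq> Gen_B" "snd (hd vs) = e"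
      using Suc.prems(1,2) ws y that by (cases vs; auto simp: syllabic_Cons alternating_chain_def)+
    then show ?thesis using other_iff[of Gen_B "fst (hd vs)"] by (simp add: prod_eq_iff)
  qed
  have "alternating_chain vs"
    using alternating_chain_sublist[OF _ Suc.prems(2), of vs] ws by (simp add: sublist_Cons_right)
  then have "spell vs = concat (replicate k (letter_power Gen_A e @ letter_power Gen_B (- e)))"
    using Suc.IH[of vs] hd Suc.prems(1,3) ws by (simp add: syllabic_Cons)
  then show ?case by (simp add: ws x y)
qed simp

lemma special_2_spell_chain:
  assumes "syllabic ws" "alternating_chain ws" "length ws = 2 * k" "ws \<noteq> [] \<Longrightarrow> fst (hd ws) = Gen_A"
  shows "special_2 k (spell ws)"
proof (cases "ws = []")
  case True
  then show ?thesis using assms(3) by (simp add: special_2_def)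
next
  case False
  define e where "e = snd (hd ws)"
  have "\<bar>e\<bar> = 1" using False assms(2) by (simp add: e_def alternating_chain_def unit_chain_def)
  then have "e = 1 \<or> e = -1" by linarith
  moreover have "hd ws = (Gen_A, e)" using False assms(4) by (simp add: e_def prod_eq_iff)
  ultimately show ?thesis
    using special_2_spell[OF assms(1-3)] by (auto simp: special_2_def)
qed

lemma special_i_spell_chain:
  assumes "syllabic ws" "unit_chain ws" "length ws = 2 * k" "ws \<noteq> [] \<Longrightarrow> fst (hd ws) = Gen_A"
  shows "special_i (2 * k) (spell ws)"
proof -
  have gens: "fst (ws ! j) = (if even j then Gen_A else Gen_B)" if "j < 2 * k" for j
    using that
  proof (induction j)
    case 0
    then show ?case using assms(3,4) by (cases ws) auto
  next
    case (Suc j)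
    have "distinct_adj (map fst ws)" using assms(1) by (simp add: syllabic_def)
    then have "fst (ws ! j) \<noteq> fst (ws ! Suc j)"
      using Suc.prems assms(3) by (simp add: distinct_adj_conv_nth)
    then have "fst (ws ! Suc j) = other (fst (ws ! j))" using other_iff by blast
    then show ?case using Suc by auto
  qed
  have "map (\<lambda>(s, n). letter_power s n) ws =
      map (\<lambda>j. letter_power (if odd j then Gen_A else Gen_B) (snd (ws ! (j - 1)))) [1..<Suc (2 * k)]"
    using gens assms(3) by (intro nth_equalityI) (auto simp: case_prod_beta nth_append simp del: upt_Suc)
  moreover have "snd (ws ! (j - 1)) \<in> {1, -1}" if "j \<in> {1..2 * k}" for j
  proof -
    have "ws ! (j - 1) \<in> set ws" using that assms(3) by (intro nth_mem) auto
    then have "\<bar>snd (ws ! (j - 1))\<bar> = 1" using assms(2) by (simp add: unit_chain_def)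
    then show ?thesis by (auto simp: abs_if split: if_splits)
  qed
  ultimately show ?thesis unfolding special_i_def spell_def
    by (intro conjI exI[of _ "\<lambda>j. snd (ws ! (j - 1))"]) auto
qed

text \<open>The surplus syllable pays for dropping a leading power of \<open>B\<close>.\<close>

lemma trim_to_start_A:
  fixes zs :: "(gen \<times> int) list"
  assumes "syllabic zs" "2 * N + 1 \<le> length zs"
  shows "\<exists>ws. sublist ws zs \<and> length ws = 2 * N \<and> (ws \<noteq> [] \<longrightarrow> fst (hd ws) = Gen_A)"
proof -
  obtain z zs' where z: "zs = z # zs'" using assms(2) by (cases zs) auto
  show ?thesis
  proof (cases "fst z = Gen_A")
    case True
    then have "take (2 * N) zs \<noteq> [] \<longrightarrow> fst (hd (take (2 * N) zs)) = Gen_A"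
      by (auto simp: z)
    then show ?thesis
      using assms(2) by (intro exI[of _ "take (2 * N) zs"]) auto
  next
    case False
    then have "fst z = Gen_B" by (cases "fst z") auto
    then have "zs' \<noteq> [] \<longrightarrow> fst (hd zs') = Gen_A"
      using assms(1) z by (cases "fst (hd zs')") (auto simp: syllabic_Cons)
    then have "take (2 * N) zs' \<noteq> [] \<longrightarrow> fst (hd (take (2 * N) zs')) = Gen_A"
      by auto
    moreover have "sublist (take (2 * N) zs') zs"
      unfolding z by (simp add: sublist_Cons_right)
    ultimately show ?thesis
      using assms(2) z by (intro exI[of _ "take (2 * N) zs'"]) auto
  qed
qed

text \<open>Otherwise all chains in the syllable form have length at most \<open>2 N + 1\<close>, and then the
  perturbation is too small for any denominator to vanish. The factor \<open>16 (N + 2)\<^sup>2\<close> dominates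
  \<open>(2 t + 3) (2 t + 4)\<close> for \<open>t \<le> 2 N + 1\<close>.\<close>

lemma relator_contains_special:
  assumes "\<mu> \<in> {2, \<i>}" and close: "16 * norm (l - 2) * (real N + 2)\<^sup>2 \<le> 1" and "G_relator l \<mu> r"
  shows "\<exists>w. sublist w r \<and> syl w = 2 * N \<and> syl w \<le> syl r \<and>
    (\<mu> = 2 \<longrightarrow> special_2 N w) \<and> (\<mu> = \<i> \<longrightarrow> special_i (2 * N) w)"
proof -
  define C where "C = (if \<mu> = 2 then alternating_chain else unit_chain :: (gen \<times> int) list \<Rightarrow> bool)"
  have "reduced r" using assms(3) by (simp add: relator_def)
  then obtain ys where ys: "syllabic ys" "r = spell ys" using reduced_imp_spell by blast
  have "\<exists>zs. sublist zs ys \<and> C zs \<and> 2 * N + 1 < length zs"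
  proof (rule ccontr)
    assume none: "\<not> ?thesis"
    have short: "norm (l - 2) * (2 * length zs + 3) * (2 * length zs + 4) \<le> 1" if "sublist zs ys" "C zs" for zs
    proof -
      have "length zs \<le> 2 * N + 1" using none that by fastforce
      then have "real (2 * length zs + 3) * real (2 * length zs + 4) \<le> (4 * (real N + 2)) * (4 * (real N + 2))"
        by (intro mult_mono) auto
      then have "norm (l - 2) * (real (2 * length zs + 3) * real (2 * length zs + 4)) \<le>
          norm (l - 2) * ((4 * (real N + 2)) * (4 * (real N + 2)))"
        by (intro mult_left_mono) auto
      also have "\<dots> = 16 * norm (l - 2) * (real N + 2)\<^sup>2"
  by (simp add: power2_eq_square algebra_simps)
      finally show ?thesis using close by (simp add: mult.assoc)
    qed
    have "ratio l \<mu> xs \<noteq> 0" if "suffix xs ys" "xs \<noteq> []" for xs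
    proof (cases "\<mu> = 2")
      case True
      then show ?thesis
        using ratio_nonzero_2[OF refl short ys(1) that] by (simp add: C_def)
    next
      case False
      then have "\<mu> = \<i>" using assms(1) by simp
      then show ?thesis
        using ratio_nonzero_i[OF refl short ys(1) that] False by (simp add: C_def)
    qed
    then have "\<not> G_relator l \<mu> (spell ys)"
      by (rule not_relator_spell[OF ys(1)])
    then show False using assms(3) ys(2) by simp
  qed
  then obtain zs where zs: "sublist zs ys" "C zs" "2 * N + 1 \<le> length zs" by auto
  have "syllabic zs" using syllabic_sublist zs(1) ys(1) by blast
  then obtain ws where ws: "sublist ws zs" "length ws = 2 * N" "ws \<noteq> [] \<longrightarrow> fst (hd ws) = Gen_A"
    using trim_to_start_A zs(3) by blast
  have wsy: "sublist ws ys" using ws(1) zs(1) sublist_order.order.trans by blast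
  then have syll: "syllabic ws" using syllabic_sublist ys(1) by blast
  have "special_2 N (spell ws)" if "\<mu> = 2"
    using that zs(2) alternating_chain_sublist[OF ws(1)] ws syll
    by (intro special_2_spell_chain) (auto simp: C_def)
  moreover have "special_i (2 * N) (spell ws)" if "\<mu> = \<i>"
  proof -
    have "\<mu> \<noteq> 2" using that by (simp add: complex_eq_iff)
    then show ?thesis
      using zs(2) unit_chain_sublist[OF ws(1)] ws syll
      by (intro special_i_spell_chain) (auto simp: C_def)
  qed
  moreover have "length ws \<le> length ys" using wsy by (rule sublist_length_le)
  ultimately show ?thesis
    using sublist_spell[OF wsy] syl_spell[OF syll] syl_spell[OF ys(1)] ws(2) ys(2)
    by (intro exI[of _ "spell ws"]) simp
qed

section \<open>A program for the lower bound\<close>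

lemma computes_comp1:
  "computes f q xs a \<Longrightarrow> computes f p [a] z \<Longrightarrow> computes f (Comp p [q]) xs z"
  by (rule computes.comp[where ys = "[a]"]) auto

lemma computes_comp2:
  "computes f q xs a \<Longrightarrow> computes f q' xs b \<Longrightarrow> computes f p [a, b] z \<Longrightarrow>
    computes f (Comp p [q, q']) xs z"
  by (rule computes.comp[where ys = "[a, b]"]) auto

lemma computes_comp3:
  "computes f q xs a \<Longrightarrow> computes f q' xs b \<Longrightarrow> computes f q'' xs c \<Longrightarrow> computes f p [a, b, c] z \<Longrightarrow>
    computes f (Comp p [q, q', q'']) xs z"
  by (rule computes.comp[where ys = "[a, b, c]"]) auto

lemma computes_proj: "i < length xs \<Longrightarrow> y = xs ! i \<Longrightarrow> computes f (Proj i) xs y"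
  by (simp add: computes.proj)

fun const_prog :: "nat \<Rightarrow> prog" where
  "const_prog 0 = Zero"
| "const_prog (Suc k) = Comp Succ [const_prog k]"

lemma computes_const: "computes f (const_prog k) xs k"
  by (induction k) (auto intro: computes.intros computes_comp1)

definition add_prog :: prog where
  "add_prog = PrimRec (Proj 0) (Comp Succ [Proj 1])"

lemma computes_add: "computes f add_prog [x, y] (x + y)"
  unfolding add_prog_def
proof (induction x)
  case 0
  then show ?case by (auto intro!: computes.rec_0 computes_proj)
next
  case (Suc x)
  have "computes f (Comp Succ [Proj 1]) [x, x + y, y] (Suc (x + y))"
    by (rule computes_comp1[OF _ computes.succ]) (auto intro!: computes_proj)
  then show ?case using computes.rec_Suc[OF Suc] by simp
qed

definition mult_prog :: prog where
  "mult_prog = PrimRec Zero (Comp add_prog [Proj 2, Proj 1])"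

lemma computes_mult: "computes f mult_prog [x, y] (x * y)"
  unfolding mult_prog_def
proof (induction x)
  case 0
  then show ?case by (simp add: computes.rec_0 computes.zero)
next
  case (Suc x)
  have "computes f (Comp add_prog [Proj 2, Proj 1]) [x, x * y, y] (y + x * y)"
    by (rule computes_comp2[OF _ _ computes_add]) (auto intro!: computes_proj)
  then show ?case using computes.rec_Suc[OF Suc] by simp
qed

definition pred_prog :: prog where
  "pred_prog = PrimRec Zero (Proj 0)"

lemma computes_pred: "computes f pred_prog [x] (x - 1)"
proof (induction x)
  case 0
  then show ?case by (simp add: pred_prog_def computes.rec_0 computes.zero)
next
  case (Suc x)
  have "computes f (Proj 0) [x, x - 1] x" by (rule computes_proj) auto
  then show ?case using computes.rec_Suc[OF Suc[unfolded pred_prog_def]] by (simp add: pred_prog_def)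
qed

text \<open>Recursion runs over the first argument, so this is subtraction with its arguments swapped.\<close>

definition monus_prog :: prog where
  "monus_prog = PrimRec (Proj 0) (Comp pred_prog [Proj 1])"

lemma computes_monus: "computes f monus_prog [y, x] (x - y)"
  unfolding monus_prog_def
proof (induction y)
  case 0
  then show ?case by (auto intro!: computes.rec_0 computes_proj)
next
  case (Suc y)
  have "computes f (Comp pred_prog [Proj 1]) [y, x - y, x] (x - y - 1)"
    by (rule computes_comp1[OF _ computes_pred]) (auto intro!: computes_proj)
  then show ?case using computes.rec_Suc[OF Suc] by simp
qed

definition pow2_prog :: prog where
  "pow2_prog = PrimRec (const_prog 1) (Comp add_prog [Proj 1, Proj 1])"

lemma computes_pow2: "computes f pow2_prog [n] (2 ^ n)"
  unfolding pow2_prog_def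
proof (induction n)
  case 0
  then show ?case using computes.rec_0[OF computes_const[of f 1]] by simp
next
  case (Suc n)
  have "computes f (Comp add_prog [Proj 1, Proj 1]) [n, 2 ^ n] (2 ^ n + 2 ^ n)"
    by (rule computes_comp2[OF _ _ computes_add]) (auto intro!: computes_proj)
  then show ?case using computes.rec_Suc[OF Suc] by (simp add: mult_2)
qed

definition parity_prog :: prog where
  "parity_prog = PrimRec Zero (Comp monus_prog [Proj 1, const_prog 1])"

lemma computes_parity: "computes f parity_prog [n] (n mod 2)"
  unfolding parity_prog_def
proof (induction n)
  case 0
  then show ?case by (simp add: computes.rec_0 computes.zero)
next
  case (Suc n)
  have "computes f (Comp monus_prog [Proj 1, const_prog 1]) [n, n mod 2] (1 - n mod 2)"
    by (rule computes_comp2[OF _ computes_const computes_monus]) (auto intro!: computes_proj)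
  moreover have "1 - n mod 2 = Suc n mod 2" by (simp add: mod_Suc)
  ultimately show ?case using computes.rec_Suc[OF Suc] by simp
qed

definition sum_of where "sum_of p q = Comp add_prog [p, q]"
definition product_of where "product_of p q = Comp mult_prog [p, q]"
definition monus_of where "monus_of p q = Comp monus_prog [q, p]"

lemma computes_sum_of: "computes f p xs a \<Longrightarrow> computes f q xs b \<Longrightarrow> computes f (sum_of p q) xs (a + b)"
  unfolding sum_of_def using computes_comp2 computes_add by blast

lemma computes_product_of: "computes f p xs a \<Longrightarrow> computes f q xs b \<Longrightarrow> computes f (product_of p q) xs (a * b)"
  unfolding product_of_def using computes_comp2 computes_mult by blast

lemma computes_monus_of: "computes f p xs a \<Longrightarrow> computes f q xs b \<Longrightarrow> computes f (monus_of p q) xs (a - b)"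
  unfolding monus_of_def using computes_comp2 computes_monus by blast

text \<open>With \<open>a\<close> the integer coded by \<open>m = f [0, n, n]\<close>, the first summands are \<open>\<bar>m - 4 \<cdot> 2\<^sup>n\<bar>\<close>. If \<open>a \<ge> 0\<close>, its code
  is \<open>m = 2 a\<close>, so this is twice \<open>\<bar>a - 2 \<cdot> 2\<^sup>n\<bar>\<close>. If \<open>a < 0\<close>, the code is odd, and the summand with
  \<open>m mod 2\<close> provides a crude bound instead, which is good enough as this happens for only finitely many \<open>n\<close>
  when \<open>\<lambda>\<^sub>n \<rightarrow> 2\<close>. The last summands bound the imaginary part and the two rounding errors.\<close>

definition error_bound :: "(nat list \<Rightarrow> nat) \<Rightarrow> nat \<Rightarrow> nat" where
  "error_bound f n = (let m = f [0, n, n]; c = 4 * 2 ^ n in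
     ((m - c) + (c - m)) + (m mod 2) * (m + c) + (f [1, n, n] + 2))"

text \<open>These programs are run on \<open>[k, n]\<close> with \<open>k\<close> the search variable of an unbounded search, so \<open>n\<close>
  is \<open>Proj 1\<close>.\<close>

definition re_prog :: prog where "re_prog = Comp Query [Zero, Proj 1, Proj 1]"
definition im_prog :: prog where "im_prog = Comp Query [const_prog 1, Proj 1, Proj 1]"
definition scale_prog :: prog where "scale_prog = Comp pow2_prog [Proj 1]"
definition four_scale_prog :: prog where "four_scale_prog = product_of (const_prog 4) scale_prog"

definition error_prog :: prog where
  "error_prog = sum_of (sum_of (sum_of (monus_of re_prog four_scale_prog) (monus_of four_scale_prog re_prog))
      (product_of (Comp parity_prog [re_prog]) (sum_of re_prog four_scale_prog))) (sum_of im_prog (const_prog 2))"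

lemma computes_scale: "computes f scale_prog [k, n] (2 ^ n)"
  unfolding scale_prog_def
  by (rule computes_comp1[OF _ computes_pow2]) (auto intro!: computes_proj)

lemma computes_error: "computes f error_prog [k, n] (error_bound f n)"
proof -
  have re: "computes f re_prog [k, n] (f [0, n, n])"
    unfolding re_prog_def
    by (rule computes_comp3[OF computes.zero _ _ computes.query]) (auto intro!: computes_proj)
  have im: "computes f im_prog [k, n] (f [1, n, n])"
    unfolding im_prog_def
    by (rule computes_comp3[OF computes_const _ _ computes.query]) (auto intro!: computes_proj)
  have four: "computes f four_scale_prog [k, n] (4 * 2 ^ n)"
    unfolding four_scale_prog_def by (intro computes_product_of computes_const computes_scale)
  show ?thesis
    unfolding error_prog_def error_bound_def Let_def
    by (intro computes_sum_of computes_product_of computes_monus_of re im four computes_const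
        computes_comp1[OF re computes_parity])
qed

text \<open>The search stops at the first \<open>k\<close> for which the upper bound for \<open>d\<close> no longer
  guarantees \<open>16 d (k + 3)\<^sup>2 \<le> 1\<close>. By minimality the condition holds at \<open>k - 1\<close>, which is the
  hypothesis of \<open>relator_contains_special\<close> for \<open>N = k\<close>.\<close>

definition bound_prog :: prog where
  "bound_prog = Minimize (monus_of (sum_of scale_prog (const_prog 1))
     (product_of (product_of (const_prog 16) error_prog)
        (product_of (sum_of (Proj 0) (const_prog 3)) (sum_of (Proj 0) (const_prog 3)))))"

definition syllable_bound :: "(nat list \<Rightarrow> nat) \<Rightarrow> nat \<Rightarrow> nat" where
  "syllable_bound f n = (LEAST k. 2 ^ n < 16 * error_bound f n * ((k + 3) * (k + 3)))"

lemma error_bound_pos: "2 \<le> error_bound f n"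
  by (simp add: error_bound_def Let_def)

lemma syllable_bound_exists: "\<exists>k. 2 ^ n < 16 * error_bound f n * ((k + 3) * (k + 3))"
proof
  have "(2::nat) ^ n < 1 * (2 ^ n + 3)" by simp
  also have "\<dots> \<le> (2 ^ n + 3) * (2 ^ n + 3)" by (intro mult_right_mono) simp_all
  also have "\<dots> \<le> 16 * error_bound f n * ((2 ^ n + 3) * (2 ^ n + 3))"
    using error_bound_pos[of f n] by simp
  finally show "2 ^ n < 16 * error_bound f n * ((2 ^ n + 3) * (2 ^ n + 3))" .
qed

lemma computes_syllable_bound: "computes f bound_prog [n] (syllable_bound f n)"
proof -
  let ?lhs = "\<lambda>k. 16 * error_bound f n * ((k + 3) * (k + 3))"
  have body: "computes f (monus_of (sum_of scale_prog (const_prog 1))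
     (product_of (product_of (const_prog 16) error_prog)
        (product_of (sum_of (Proj 0) (const_prog 3)) (sum_of (Proj 0) (const_prog 3))))) [k, n]
     (2 ^ n + 1 - ?lhs k)" for k
    by (intro computes_monus_of computes_sum_of computes_product_of computes_const computes_scale
        computes_error computes_proj) auto
  have "2 ^ n < ?lhs (syllable_bound f n)"
    unfolding syllable_bound_def using syllable_bound_exists by (rule LeastI_ex)
  then have "2 ^ n + 1 - ?lhs (syllable_bound f n) = 0" by simp
  moreover have "\<exists>y. 2 ^ n + 1 - ?lhs k = Suc y" if "k < syllable_bound f n" for k
  proof -
    have "\<not> 2 ^ n < ?lhs k"
      using that unfolding syllable_bound_def by (rule not_less_Least)
    then show ?thesis by (intro exI[of _ "2 ^ n - ?lhs k"]) simp
  qed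
  ultimately show ?thesis
    unfolding bound_prog_def using body by (intro computes.minimize) metis+
qed

lemma int_decode_cases:
  "\<bar>int_decode m\<bar> \<le> int m" "int m \<le> 2 * \<bar>int_decode m\<bar>"
  "even m \<Longrightarrow> int m = 2 * int_decode m" "odd m \<Longrightarrow> int_decode m < 0"
  unfolding int_decode_def sum_decode_def by (auto elim!: evenE oddE)

lemma int_error_bound:
  "int (error_bound f n) = \<bar>int (f [0, n, n]) - 4 * 2 ^ n\<bar>
     + int (f [0, n, n] mod 2) * (int (f [0, n, n]) + 4 * 2 ^ n) + int (f [1, n, n]) + 2"
proof -
  define m where "m = f [0, n, n]"
  define c :: nat where "c = 4 * 2 ^ n"
  have "int ((m - c) + (c - m)) = \<bar>int m - int c\<bar>"
    by (cases "c \<le> m") (simp_all add: of_nat_diff)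
  then have "int (error_bound f n) =
      \<bar>int m - int c\<bar> + int (m mod 2) * (int m + int c) + int (f [1, n, n]) + 2"
    unfolding error_bound_def Let_def m_def[symmetric] c_def[symmetric] by simp
  then show ?thesis by (simp add: m_def c_def)
qed

lemma error_bound_dist:
  assumes "represents f l"
  shows "norm (l n - 2) \<le> error_bound f n / 2 ^ n"
proof -
  define a where "a = int_decode (f [0, n, n])"
  define b where "b = int_decode (f [1, n, n])"
  have approx: "\<bar>Re (l n) - of_int a / 2 ^ n\<bar> \<le> 1 / 2 ^ n" "\<bar>Im (l n) - of_int b / 2 ^ n\<bar> \<le> 1 / 2 ^ n"
    using assms by (auto simp: represents_def a_def b_def)
  define m where "m = f [0, n, n]"
  have "\<bar>a - 2 * 2 ^ n\<bar> \<le> \<bar>int m - 4 * 2 ^ n\<bar> + int (m mod 2) * (int m + 4 * 2 ^ n)"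
  proof (cases "even m")
    case True
    then have "int m = 2 * a" using int_decode_cases(3) by (simp add: a_def m_def)
    then have "int m - 4 * 2 ^ n = 2 * (a - 2 * 2 ^ n)" by simp
    then have "\<bar>int m - 4 * 2 ^ n\<bar> = 2 * \<bar>a - 2 * 2 ^ n\<bar>" by (simp only: abs_mult abs_numeral)
    moreover have "m mod 2 = 0" using True by presburger
    ultimately show ?thesis by simp
  next
    case False
    then have "m mod 2 = 1" by presburger
    moreover have "\<bar>a - 2 * 2 ^ n\<bar> \<le> \<bar>a\<bar> + \<bar>2 * 2 ^ n\<bar>" by (rule abs_triangle_ineq4)
    moreover have "\<bar>a\<bar> \<le> int m" unfolding a_def m_def by (rule int_decode_cases)
    ultimately show ?thesis by simp
  qed
  moreover have "\<bar>b\<bar> \<le> int (f [1, n, n])"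
    unfolding b_def by (rule int_decode_cases)
  ultimately have "\<bar>a - 2 * 2 ^ n\<bar> + \<bar>b\<bar> + 2 \<le> int (error_bound f n)"
    unfolding int_error_bound m_def by simp
  then have "real_of_int (\<bar>a - 2 * 2 ^ n\<bar> + \<bar>b\<bar> + 2) \<le> error_bound f n"
    by (metis of_int_le_iff of_int_of_nat_eq)
  then have sum: "\<bar>of_int a - 2 * 2 ^ n\<bar> + \<bar>of_int b\<bar> + 2 \<le> real (error_bound f n)" by simp
  have "norm (l n - 2) \<le> \<bar>Re (l n) - 2\<bar> + \<bar>Im (l n)\<bar>"
    using cmod_le[of "l n - 2"] by simp
  also have "\<dots> \<le> \<bar>of_int a / 2 ^ n - 2\<bar> + \<bar>of_int b / 2 ^ n\<bar> + (1 / 2 ^ n + 1 / 2 ^ n)"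
    using approx by linarith
  also have "\<dots> = (\<bar>of_int a - 2 * 2 ^ n\<bar> + \<bar>of_int b\<bar> + 2) / 2 ^ n"
  proof -
    have "of_int a / 2 ^ n - 2 = (of_int a - 2 * 2 ^ n) / (2 ^ n :: real)" by (simp add: field_simps)
    then show ?thesis by (simp add: abs_divide add_divide_distrib)
  qed
  also have "\<dots> \<le> error_bound f n / 2 ^ n" using sum by (intro divide_right_mono) auto
  finally show ?thesis .
qed

text \<open>Closeness to \<open>2\<close> forces the integer that approximates the real part to be nonnegative, so its code is even and the
  crude summand of the error bound vanishes.\<close>

lemma error_bound_le:
  assumes "represents f l" "norm (l n - 2) < 1"
  shows "error_bound f n / 2 ^ n \<le> 4 * norm (l n - 2) + 6 / 2 ^ n"
proof -
  define a where "a = int_decode (f [0, n, n])"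
  define b where "b = int_decode (f [1, n, n])"
  have pos: "(0::real) < 2 ^ n" by simp
  have "\<bar>Re (l n) - of_int a / 2 ^ n\<bar> \<le> 1 / 2 ^ n" "\<bar>Im (l n) - of_int b / 2 ^ n\<bar> \<le> 1 / 2 ^ n"
    using assms by (auto simp: represents_def a_def b_def)
  then have "\<bar>Re (l n) - of_int a / 2 ^ n\<bar> * 2 ^ n \<le> 1" "\<bar>Im (l n) - of_int b / 2 ^ n\<bar> * 2 ^ n \<le> 1"
    by (simp_all add: field_simps)
  moreover have "\<bar>Re (l n) - of_int a / 2 ^ n\<bar> * 2 ^ n = \<bar>Re (l n) * 2 ^ n - of_int a\<bar>"
    "\<bar>Im (l n) - of_int b / 2 ^ n\<bar> * 2 ^ n = \<bar>Im (l n) * 2 ^ n - of_int b\<bar>"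
    using abs_mult_pos[of "2 ^ n :: real"] by (simp_all add: field_simps)
  ultimately have approx: "\<bar>Re (l n) * 2 ^ n - of_int a\<bar> \<le> 1" "\<bar>Im (l n) * 2 ^ n - of_int b\<bar> \<le> 1"
    by simp_all
  define E where "E = norm (l n - 2)"
  have "\<bar>Re (l n) - 2\<bar> \<le> E" "\<bar>Im (l n)\<bar> \<le> E"
    using abs_Re_le_cmod[of "l n - 2"] abs_Im_le_cmod[of "l n - 2"] by (simp_all add: E_def)
  then have "\<bar>Re (l n) - 2\<bar> * 2 ^ n \<le> E * 2 ^ n" "\<bar>Im (l n)\<bar> * 2 ^ n \<le> E * 2 ^ n"
    by (simp_all add: mult_right_mono)
  moreover have "\<bar>Re (l n) - 2\<bar> * 2 ^ n = \<bar>Re (l n) * 2 ^ n - 2 * 2 ^ n\<bar>"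
    "\<bar>Im (l n)\<bar> * 2 ^ n = \<bar>Im (l n) * 2 ^ n\<bar>"
    using abs_mult_pos[of "2 ^ n :: real"] by (simp_all add: left_diff_distrib)
  ultimately have "\<bar>Re (l n) * 2 ^ n - 2 * 2 ^ n\<bar> \<le> E * 2 ^ n" "\<bar>Im (l n) * 2 ^ n\<bar> \<le> E * 2 ^ n"
    by simp_all
  with approx have ab: "\<bar>of_int a - 2 * 2 ^ n\<bar> \<le> E * 2 ^ n + 1" "\<bar>of_int b\<bar> \<le> E * 2 ^ n + 1"
    by linarith+
  have "E * 2 ^ n < 2 ^ n" using assms(2) by (simp add: E_def)
  then have "real_of_int a > -1" using ab(1) one_le_power[of "2::real" n] by linarith
  then have "a \<ge> 0" by linarith
  then have ev: "even (f [0, n, n])" using int_decode_cases(4)[of "f [0, n, n]"] by (auto simp: a_def)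
  then have m: "int (f [0, n, n]) = 2 * a" using int_decode_cases(3) by (simp add: a_def)
  have m': "int (f [1, n, n]) \<le> 2 * \<bar>b\<bar>" unfolding b_def by (rule int_decode_cases)
  have "f [0, n, n] mod 2 = 0" using ev by presburger
  then have "int (error_bound f n) = \<bar>int (f [0, n, n]) - 4 * 2 ^ n\<bar> + int (f [1, n, n]) + 2"
    by (simp add: int_error_bound)
  also have "\<bar>int (f [0, n, n]) - 4 * 2 ^ n\<bar> = 2 * \<bar>a - 2 * 2 ^ n\<bar>"
  proof -
    have "int (f [0, n, n]) - 4 * 2 ^ n = 2 * (a - 2 * 2 ^ n)" using m by simp
    then show ?thesis by (simp only: abs_mult abs_numeral)
  qed
  also have "2 * \<bar>a - 2 * 2 ^ n\<bar> + int (f [1, n, n]) + 2 \<le> 2 * \<bar>a - 2 * 2 ^ n\<bar> + 2 * \<bar>b\<bar> + 2"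
    using m' by simp
  finally have "real_of_int (int (error_bound f n)) \<le> of_int (2 * \<bar>a - 2 * 2 ^ n\<bar> + 2 * \<bar>b\<bar> + 2)"
    by (subst of_int_le_iff)
  then have "real (error_bound f n) \<le> 2 * \<bar>of_int a - 2 * 2 ^ n\<bar> + 2 * \<bar>of_int b\<bar> + 2" by simp
  also have "\<dots> \<le> 2 * (E * 2 ^ n + 1) + 2 * (E * 2 ^ n + 1) + 2"
    using ab by (intro add_mono mult_left_mono) simp_all
  finally have "real (error_bound f n) \<le> 4 * (E * 2 ^ n) + 6" by simp
  then show ?thesis using pos by (simp add: E_def field_simps)
qed

text \<open>The error bound divided by \<open>2\<^sup>n\<close> tends to \<open>0\<close>, so every fixed \<open>M\<close> eventually passes the test for
  continuing the search, and so do all smaller numbers.\<close>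

lemma syllable_bound_at_top:
  assumes "represents f l" "l \<longlonglongrightarrow> 2"
  shows "filterlim (syllable_bound f) at_top sequentially"
proof -
  have norm0: "(\<lambda>n. norm (l n - 2)) \<longlonglongrightarrow> 0"
    using assms(2) tendsto_norm_zero LIM_zero by blast
  then have near: "eventually (\<lambda>n. norm (l n - 2) < 1) sequentially"
    by (rule order_tendstoD) simp
  have "(\<lambda>n. 6 / 2 ^ n :: real) \<longlonglongrightarrow> 0"
    using tendsto_mult_right_zero[OF LIMSEQ_inverse_realpow_zero[of 2], of 6]
    by (simp add: divide_inverse)
  then have upper: "(\<lambda>n. 4 * norm (l n - 2) + 6 / 2 ^ n) \<longlonglongrightarrow> 0"
    using tendsto_add[OF tendsto_mult_right_zero[OF norm0, of 4]] by fastforce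
  show ?thesis
    unfolding filterlim_at_top
  proof
    fix M
    define q where "q = 16 * ((real M + 3) * (real M + 3))"
    have "q > 0" by (simp add: q_def add_pos_pos)
    then have "eventually (\<lambda>n. 4 * norm (l n - 2) + 6 / 2 ^ n < 1 / q) sequentially"
      by (intro order_tendstoD(2)[OF upper]) simp
    with near show "eventually (\<lambda>n. M \<le> syllable_bound f n) sequentially"
    proof eventually_elim
      case (elim n)
      have "error_bound f n / 2 ^ n < 1 / q"
        using error_bound_le[OF assms(1) elim(1)] elim(2) by linarith
      then have "real (error_bound f n) * q < 2 ^ n"
        using \<open>q > 0\<close> by (simp add: field_simps)
      then have "real (16 * error_bound f n * ((M + 3) * (M + 3))) < real (2 ^ n)"
        by (simp add: q_def algebra_simps)
      then have small: "16 * error_bound f n * ((M + 3) * (M + 3)) < 2 ^ n"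
        by (simp only: of_nat_less_iff)
      show ?case
      proof (rule ccontr)
        let ?k = "syllable_bound f n"
        assume "\<not> M \<le> ?k"
        then have "16 * error_bound f n * ((?k + 3) * (?k + 3)) \<le> 16 * error_bound f n * ((M + 3) * (M + 3))"
          by (intro mult_mono) auto
        moreover have "2 ^ n < 16 * error_bound f n * ((?k + 3) * (?k + 3))"
          unfolding syllable_bound_def using syllable_bound_exists by (rule LeastI_ex)
        ultimately show False using small by linarith
      qed
    qed
  qed
qed

lemma syllable_bound_close:
  assumes "represents f l" "syllable_bound f n \<noteq> 0"
  shows "16 * norm (l n - 2) * (real (syllable_bound f n) + 2)\<^sup>2 \<le> 1"
proof -
  obtain k where k: "syllable_bound f n = Suc k" using assms(2) not0_implies_Suc by blast
  have "\<not> 2 ^ n < 16 * error_bound f n * ((k + 3) * (k + 3))"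
    using k not_less_Least[of k "\<lambda>k. 2 ^ n < 16 * error_bound f n * ((k + 3) * (k + 3))"]
    by (simp add: syllable_bound_def)
  then have "real (16 * error_bound f n * ((k + 3) * (k + 3))) \<le> real (2 ^ n)"
    by (simp only: of_nat_le_iff not_less)
  then have "16 * real (error_bound f n) * (real (Suc k) + 2)\<^sup>2 \<le> 2 ^ n"
    by (simp add: power2_eq_square algebra_simps)
  then have "16 * (error_bound f n / 2 ^ n) * (real (Suc k) + 2)\<^sup>2 \<le> 1"
    by (simp add: divide_le_eq)
  moreover have "16 * norm (l n - 2) * (real (Suc k) + 2)\<^sup>2 \<le> 16 * (error_bound f n / 2 ^ n) * (real (Suc k) + 2)\<^sup>2"
    using error_bound_dist[OF assms(1)] by (intro mult_right_mono mult_left_mono) auto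
  ultimately show ?thesis unfolding k by linarith
qed

section \<open>The theorem\<close>

theorem theorem1p2:
  fixes \<mu> :: complex
  assumes "\<mu> \<in> {2, \<i>}"
  shows "(\<forall>N::nat. \<exists>U::complex set. open U \<and> 2 \<in> U \<and>
           (\<forall>l\<in>U. \<forall>r. G_relator l \<mu> r \<longrightarrow>
              (\<mu> = 2 \<longrightarrow> (\<exists>w k. sublist w r \<and> k \<ge> N \<and> special_2 k w)) \<and>
              (\<mu> = \<i> \<longrightarrow> (\<exists>w k. sublist w r \<and> k \<ge> N \<and> special_i k w))))
       \<and> ((\<lambda>l. syl_sigma (G_group l \<mu>) (gen_matrix l \<mu>)) \<longlongrightarrow> \<infinity>) (at 2)
       \<and> (\<exists>p::prog. \<forall>(l::nat \<Rightarrow> complex) f. l \<longlonglongrightarrow> 2 \<longrightarrow> represents f l \<longrightarrow>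
           (\<exists>K::nat \<Rightarrow> nat. (\<forall>n. computes f p [n] (K n)) \<and> filterlim K at_top sequentially \<and>
              (\<forall>n r. G_relator (l n) \<mu> r \<longrightarrow>
                 (\<mu> = 2 \<longrightarrow> (\<exists>w k. sublist w r \<and> syl w \<ge> K n \<and> special_2 k w)) \<and>
                 (\<mu> = \<i> \<longrightarrow> (\<exists>w k. sublist w r \<and> syl w \<ge> K n \<and> special_i k w)))))"
proof (intro conjI allI)
  define nbhd where "nbhd N = ball (2::complex) (1 / (16 * (real N + 2)\<^sup>2))" for N
  have nbhd: "open (nbhd N)" "2 \<in> nbhd N" for N
    by (auto simp: nbhd_def)
  have close: "16 * norm (l - 2) * (real N + 2)\<^sup>2 \<le> 1" if "l \<in> nbhd N" for l N
  proof -
    have "norm (l - 2) < 1 / (16 * (real N + 2)\<^sup>2)"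
      using that by (simp add: nbhd_def dist_norm norm_minus_commute)
    moreover have "0 < 16 * (real N + 2)\<^sup>2" by (simp add: add_pos_pos)
    ultimately show ?thesis by (simp add: pos_less_divide_eq mult_ac)
  qed
  note special = relator_contains_special[OF assms]
  show "\<exists>U::complex set. open U \<and> 2 \<in> U \<and>
           (\<forall>l\<in>U. \<forall>r. G_relator l \<mu> r \<longrightarrow>
              (\<mu> = 2 \<longrightarrow> (\<exists>w k. sublist w r \<and> k \<ge> N \<and> special_2 k w)) \<and>
              (\<mu> = \<i> \<longrightarrow> (\<exists>w k. sublist w r \<and> k \<ge> N \<and> special_i k w)))" for N
  proof (intro exI[of _ "nbhd N"] conjI nbhd ballI allI impI)
    fix l r assume l: "l \<in> nbhd N" and r: "G_relator l \<mu> r"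
    obtain w where w: "sublist w r" "\<mu> = 2 \<longrightarrow> special_2 N w" "\<mu> = \<i> \<longrightarrow> special_i (2 * N) w"
      using special[OF close[OF l] r] by blast
    show "\<exists>w k. sublist w r \<and> k \<ge> N \<and> special_2 k w" if "\<mu> = 2"
      using w that by blast
    show "\<exists>w k. sublist w r \<and> k \<ge> N \<and> special_i k w" if "\<mu> = \<i>"
      using w that by (intro exI[of _ w] exI[of _ "2 * N"]) simp
  qed
  show "((\<lambda>l. syl_sigma (G_group l \<mu>) (gen_matrix l \<mu>)) \<longlongrightarrow> \<infinity>) (at 2)"
  proof (rule order_tendstoI)
    fix a :: enat assume "a < \<infinity>"
    then obtain N where N: "a = enat N" by (cases a) auto
    have "a < syl_sigma (G_group l \<mu>) (gen_matrix l \<mu>)" if "l \<in> nbhd (Suc N)" for l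
    proof -
      have "enat (Suc N) \<le> enat (syl r)" if "G_relator l \<mu> r" for r
        using special[OF close[OF \<open>l \<in> nbhd (Suc N)\<close>] that] by auto
      then have "enat (Suc N) \<le> syl_sigma (G_group l \<mu>) (gen_matrix l \<mu>)"
        unfolding syl_sigma_def by (auto intro: INF_greatest)
      moreover have "a < enat (Suc N)" by (simp add: N)
      ultimately show ?thesis by (rule less_le_trans[rotated])
    qed
    then show "eventually (\<lambda>l. a < syl_sigma (G_group l \<mu>) (gen_matrix l \<mu>)) (at 2)"
      unfolding eventually_at_topological using nbhd by blast
  qed simp
  show "\<exists>p::prog. \<forall>(l::nat \<Rightarrow> complex) f. l \<longlonglongrightarrow> 2 \<longrightarrow> represents f l \<longrightarrow>
           (\<exists>K::nat \<Rightarrow> nat. (\<forall>n. computes f p [n] (K n)) \<and> filterlim K at_top sequentially \<and>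
              (\<forall>n r. G_relator (l n) \<mu> r \<longrightarrow>
                 (\<mu> = 2 \<longrightarrow> (\<exists>w k. sublist w r \<and> syl w \<ge> K n \<and> special_2 k w)) \<and>
                 (\<mu> = \<i> \<longrightarrow> (\<exists>w k. sublist w r \<and> syl w \<ge> K n \<and> special_i k w))))"
  proof (intro exI[of _ bound_prog] allI impI)
    fix l :: "nat \<Rightarrow> complex" and f
    assume lim: "l \<longlonglongrightarrow> 2" and rep: "represents f l"
    have main: "(\<exists>w k. sublist w r \<and> syl w \<ge> syllable_bound f n \<and> (\<mu> = 2 \<longrightarrow> special_2 k w) \<and> (\<mu> = \<i> \<longrightarrow> special_i k w))"
      if r: "G_relator (l n) \<mu> r" for n r
    proof (cases "syllable_bound f n = 0")
      \<comment> \<open>The search stopped at once, which gives no bound on the distance; the empty word suffices.\<close>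
      case True
      then show ?thesis
        by (intro exI[of _ "[]"] exI[of _ 0]) (simp add: special_2_def special_i_def)
    next
      case False
      obtain w where w: "sublist w r" "syl w = 2 * syllable_bound f n"
        "\<mu> = 2 \<longrightarrow> special_2 (syllable_bound f n) w" "\<mu> = \<i> \<longrightarrow> special_i (2 * syllable_bound f n) w"
        using special[OF syllable_bound_close[OF rep False] r] by blast
      have "\<mu> = 2 \<longrightarrow> \<mu> \<noteq> \<i>" by (simp add: complex_eq_iff)
      then show ?thesis
        using w by (intro exI[of _ w] exI[of _ "if \<mu> = 2 then syllable_bound f n else 2 * syllable_bound f n"]) auto
    qed
    show "\<exists>K::nat \<Rightarrow> nat. (\<forall>n. computes f bound_prog [n] (K n)) \<and> filterlim K at_top sequentially \<and>
              (\<forall>n r. G_relator (l n) \<mu> r \<longrightarrow>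
                 (\<mu> = 2 \<longrightarrow> (\<exists>w k. sublist w r \<and> syl w \<ge> K n \<and> special_2 k w)) \<and>
                 (\<mu> = \<i> \<longrightarrow> (\<exists>w k. sublist w r \<and> syl w \<ge> K n \<and> special_i k w)))"
    proof (intro exI[of _ "syllable_bound f"] conjI allI impI)
      show "computes f bound_prog [n] (syllable_bound f n)" for n
        by (rule computes_syllable_bound)
      show "filterlim (syllable_bound f) at_top sequentially"
        by (rule syllable_bound_at_top[OF rep lim])
      fix n r assume r: "G_relator (l n) \<mu> r"
      show "\<exists>w k. sublist w r \<and> syl w \<ge> syllable_bound f n \<and> special_2 k w" if "\<mu> = 2"
        using main[OF r] that by metis
      show "\<exists>w k. sublist w r \<and> syl w \<ge> syllable_bound f n \<and> special_i k w" if "\<mu> = \<i>"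
        using main[OF r] that by metis
    qed
  qed
qed

end
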